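(* Consider the signal and measurement model $$dx_t=f(x_t)\,dt+g(x_t)\,d\beta_t,\qquad dy_t=h(x_t)\,dt+R^{1/2}(t)\,d\eta_t,\qquad t\ge t_0,$$ with true posterior $\pi^*_t(x\mid Y_t)$, the conditional density of the signal given the measurements $Y_t=\{y_\tau: t_0\le\tau\le t\}$. Consider the feedback particle filter with stochastically perturbed innovation, whose particles $x^i_t$ are governed by the controlled Stratonovich SDE $$dx^i_t=f(x^i_t)\,dt+g(x^i_t)\,d\beta^i_t+K(x^i_t)\circ\bigl(dy_t+R^{1/2}(t)\,d\eta^i_t-h(x^i_t)\,dt\bigr),$$ where the gain is $K=\nabla\phi$ and $\phi$ satisfies the Poisson equation $$\nabla\cdot\bigl(\pi_t(x\mid Y_t)\nabla\phi(x)\bigr)=-(h-\hat h_t)\,\pi_t(x\mid Y_t)\,R^{-1}(t),\qquad \int\phi(x)\,\pi_t(x\mid Y_t)\,dx=0,$$ and $\pi_t(x\mid Y_t)$, the filter posterior, is the conditional density of the particle $x^i_t$ given $Y_t$. Let the initial filter posterior $\pi_{t_0}$ be equal to the true posterior $\pi^*_{t_0}$ at time $t_0$. Then this filter is exact, i.e. the filter posterior matches the true posterior, $\pi_t=\pi^*_t$, at all times $t\ge t_0$.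
   Context: Here $x_t$ is an $n\times1$ state vector, $f$ ($n\times1$) the drift, $g$ ($n\times m$) the diffusion function, $\beta_t$ an $m$-dimensional Brownian motion, $y_t$ an $r\times1$ output, $h$ ($r\times1$) the sensor function, $R(t)$ an $r\times r$ time-dependent matrix, and $\eta_t$ an $r$-dimensional standard Brownian motion; $f,g,h$ may also depend on $t$. The $\beta^i$ and $\eta^i$ are independent copies of $\beta$ and $\eta$. $\hat h_t$ is the conditional mean of $h$ under the posterior in question. The Itô form of the filter SDE is $$dx^i_t=f\,dt+g\,d\beta^i_t+2q\,dt+K\bigl(dy_t+R^{1/2}(t)\,d\eta^i_t-h\,dt\bigr),\qquad q_j=\frac R2\sum_{k=1}^nK_k\frac{\partial K_j}{\partial x_k},$$ with coefficients evaluated at $(x^i_t,t)$. The formulas for $q$ and for the Poisson equation are written with a single index on $K$, as for one-dimensional measurements. The filter posterior evolves by the Fokker–Planck equation of this Itô SDE, $$d\pi_t=\mathcal L(\pi_t)\,dt-\nabla\cdot(\pi_tK)\,dy_t-\nabla\cdot(\pi_tU)\,dt+\sum_{k,l=1}^n\frac{\partial^2}{\partial x_k\partial x_l}\bigl(\pi_t(KRK^{\mathrm T})_{kl}\bigr)dt,\qquad U=-Kh+2q,$$ and the true posterior evolves by $$d\pi^*_t=\mathcal L(\pi^*_t)\,dt+\pi^*_t(h-\hat h_t)^{\mathrm T}R^{-1}(t)(dy_t-\hat h_t\,dt),$$ where $\mathcal L$ is the Fokker–Planck (forward Kolmogorov) operator of the signal SDE. Exactness is understood in the sense that, starting from equal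 initial posteriors, the evolution equations of the two posteriors are the same. *)

theory Defs
  imports "HOL-Probability.Probability"
begin

text \<open>Vectors in $\<real>^n$, $\<real>^m$, $\<real>^r$ are \<open>real ^ 'n\<close>, \<open>real ^ 'm\<close>, \<open>real ^ 'r\<close>; an
  \<open>n \<times> r\<close> matrix has type \<open>real ^ 'r ^ 'n\<close>, so that \<open>A $ k $ a\<close> is the entry in row \<open>k\<close> and
  column \<open>a\<close>.\<close>

subsection \<open>Classical derivatives\<close>

definition partial :: "'n \<Rightarrow> (real ^ 'n \<Rightarrow> real) \<Rightarrow> real ^ 'n \<Rightarrow> real" where
  "partial k u x = deriv (\<lambda>s. u (x + s *\<^sub>R axis k 1)) 0"

text \<open>\<open>C_diff k u\<close>: the function \<open>u\<close> is $k$ times continuously differentiable.\<close>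

primrec C_diff :: "nat \<Rightarrow> (real ^ 'n \<Rightarrow> real) \<Rightarrow> bool" where
  "C_diff 0 u = continuous_on UNIV u"
| "C_diff (Suc k) u = ((\<forall>x. u differentiable (at x)) \<and> (\<forall>j. C_diff k (partial j u)))"

definition divergence :: "(real ^ 'n \<Rightarrow> real ^ 'n) \<Rightarrow> real ^ 'n \<Rightarrow> real" where
  "divergence V x = (\<Sum>k\<in>UNIV. partial k (\<lambda>z. V z $ k) x)"

subsection \<open>Matrices\<close>

definition positive_definite :: "real ^ 'r ^ 'r \<Rightarrow> bool" where
  "positive_definite A \<longleftrightarrow> transpose A = A \<and> (\<forall>v. v \<noteq> 0 \<longrightarrow> 0 < v \<bullet> (A *v v))"

text \<open>The symmetric positive semidefinite square root (unique for positive definite \<open>A\<close>).\<close>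

definition matrix_sqrt :: "real ^ 'r ^ 'r \<Rightarrow> real ^ 'r ^ 'r" where
  "matrix_sqrt A = (THE S. transpose S = S \<and> (\<forall>v. 0 \<le> v \<bullet> (S *v v)) \<and> S ** S = A)"

subsection \<open>Processes, Brownian motion, conditional densities\<close>

definition generated_sigma ::
  "'w measure \<Rightarrow> real set \<Rightarrow> (real \<Rightarrow> 'w \<Rightarrow> 'a::topological_space) \<Rightarrow> 'w measure" where
  "generated_sigma M T X = sigma (space M) (\<Union>s\<in>T. {X s -` A \<inter> space M | A. A \<in> sets borel})"

definition brownian_motion ::
  "'w measure \<Rightarrow> (real \<Rightarrow> 'w measure) \<Rightarrow> real \<Rightarrow> (real \<Rightarrow> 'w \<Rightarrow> 'a::euclidean_space) \<Rightarrow> bool" where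
  "brownian_motion M F t0 B \<longleftrightarrow>
     (\<forall>t\<ge>t0. B t \<in> borel_measurable (F t)) \<and>
     (AE \<omega> in M. B t0 \<omega> = 0) \<and>
     (AE \<omega> in M. continuous_on {t0..} (\<lambda>t. B t \<omega>)) \<and>
     (\<forall>s t. t0 \<le> s \<and> s < t \<longrightarrow>
        prob_space.indep_set M (sets (F s))
          (sets (vimage_algebra (space M) (\<lambda>\<omega>. B t \<omega> - B s \<omega>) borel)) \<and>
        distributed M lborel (\<lambda>\<omega>. B t \<omega> - B s \<omega>)
          (\<lambda>v. ennreal (\<Prod>b\<in>Basis. normal_density 0 (sqrt (t - s)) (v \<bullet> b))))"

text \<open>\<open>p \<omega>\<close> is a version of the conditional Lebesgue density of \<open>X\<close> given the sub-\<open>\<sigma>\<close>-algebra \<open>G\<close>.\<close>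

definition conditional_density ::
  "'w measure \<Rightarrow> 'w measure \<Rightarrow> ('w \<Rightarrow> 'a::euclidean_space) \<Rightarrow> ('w \<Rightarrow> 'a \<Rightarrow> real) \<Rightarrow> bool" where
  "conditional_density M G X p \<longleftrightarrow>
     (\<lambda>(\<omega>, x). p \<omega> x) \<in> borel_measurable (G \<Otimes>\<^sub>M borel) \<and>
     (\<forall>\<omega>\<in>space M. \<forall>x. 0 \<le> p \<omega> x) \<and>
     (\<forall>A\<in>sets borel. AE \<omega> in M.
        real_cond_exp M G (indicator (X -` A \<inter> space M)) \<omega> = (LINT x:A|lborel. p \<omega> x))"

datatype noise_source =
    Signal_Noise | Measurement_Noise
  | Particle_Signal_Noise nat | Particle_Measurement_Noise nat

subsection \<open>Stochastic integrals and differentials\<close>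

text \<open>For continuous integrands the stochastic integrals are the limits in probability of the
  sums \<open>\<Sum> D s s'\<close> over consecutive points \<open>s \<le> s'\<close> of deterministic partitions of
  \<open>[t0, t]\<close> with mesh tending to 0: left-point sums for It\^o, averages of both endpoints for
  Stratonovich integrals.\<close>

definition partition_of :: "real \<Rightarrow> real \<Rightarrow> real list \<Rightarrow> bool" where
  "partition_of t0 t ts \<longleftrightarrow> ts \<noteq> [] \<and> sorted ts \<and> hd ts = t0 \<and> last ts = t"

definition riemann_limit ::
  "'w measure \<Rightarrow> real \<Rightarrow> real \<Rightarrow> (real \<Rightarrow> real \<Rightarrow> 'w \<Rightarrow> real) \<Rightarrow> ('w \<Rightarrow> real) \<Rightarrow> bool" where
  "riemann_limit M t0 t D I \<longleftrightarrow>
     (\<forall>s s'. t0 \<le> s \<and> s \<le> s' \<and> s' \<le> t \<longrightarrow> D s s' \<in> borel_measurable M) \<and>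
     I \<in> borel_measurable M \<and>
     (\<forall>\<epsilon>>0. \<exists>\<delta>>0. \<forall>ts. partition_of t0 t ts \<and>
        (\<forall>k < length ts - 1. ts ! Suc k - ts ! k < \<delta>) \<longrightarrow>
        measure M {\<omega> \<in> space M. \<epsilon> < \<bar>(\<Sum>k < length ts - 1. D (ts ! k) (ts ! Suc k) \<omega>) - I \<omega>\<bar>} < \<epsilon>)"

text \<open>\<open>I = \<integral> H \<bullet> dX\<close> over \<open>[t0, t]\<close> in the sense of It\^o, with \<open>H\<close>, \<open>X\<close> adapted with
  continuous paths.\<close>

definition ito_integral ::
  "'w measure \<Rightarrow> (real \<Rightarrow> 'w measure) \<Rightarrow> real \<Rightarrow> (real \<Rightarrow> 'w \<Rightarrow> 'a::euclidean_space) \<Rightarrow>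
   (real \<Rightarrow> 'w \<Rightarrow> 'a) \<Rightarrow> real \<Rightarrow> ('w \<Rightarrow> real) \<Rightarrow> bool" where
  "ito_integral M F t0 H X t I \<longleftrightarrow>
     (\<forall>s\<in>{t0..t}. H s \<in> borel_measurable (F s) \<and> X s \<in> borel_measurable (F s)) \<and>
     (AE \<omega> in M. continuous_on {t0..t} (\<lambda>s. H s \<omega>) \<and> continuous_on {t0..t} (\<lambda>s. X s \<omega>)) \<and>
     riemann_limit M t0 t (\<lambda>s s' \<omega>. H s \<omega> \<bullet> (X s' \<omega> - X s \<omega>)) I"

text \<open>\<open>I = \<integral> G(X) \<circ> dZ\<close> over \<open>[t0, t]\<close>. The circle refers to the dependence of the (random,
  time-dependent) field \<open>G\<close> on the state: both endpoints of a partition interval enter through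
  the state, whereas the field itself is taken at the left endpoint. If \<open>dX\<close> contains \<open>G dZ\<close>
  this yields exactly the correction term that involves the spatial derivatives of \<open>G\<close>, and no
  contribution from the covariation between \<open>Z\<close> and the explicit time dependence of \<open>G\<close>.\<close>

definition stratonovich_integral ::
  "'w measure \<Rightarrow> (real \<Rightarrow> 'w measure) \<Rightarrow> real \<Rightarrow>
   (real \<Rightarrow> 'w \<Rightarrow> 'x::euclidean_space \<Rightarrow> 'a::euclidean_space) \<Rightarrow>
   (real \<Rightarrow> 'w \<Rightarrow> 'x) \<Rightarrow> (real \<Rightarrow> 'w \<Rightarrow> 'a) \<Rightarrow> real \<Rightarrow> ('w \<Rightarrow> real) \<Rightarrow> bool" where
  "stratonovich_integral M F t0 G X Z t I \<longleftrightarrow>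
     (\<forall>s\<in>{t0..t}. (\<lambda>\<omega>. G s \<omega> (X s \<omega>)) \<in> borel_measurable (F s) \<and>
        X s \<in> borel_measurable (F s) \<and> Z s \<in> borel_measurable (F s)) \<and>
     (AE \<omega> in M. continuous_on ({t0..t} \<times> UNIV) (\<lambda>(s, x). G s \<omega> x) \<and>
        continuous_on {t0..t} (\<lambda>s. X s \<omega>) \<and> continuous_on {t0..t} (\<lambda>s. Z s \<omega>)) \<and>
     riemann_limit M t0 t
       (\<lambda>s s' \<omega>. ((1/2) *\<^sub>R (G s \<omega> (X s \<omega>) + G s \<omega> (X s' \<omega>))) \<bullet> (Z s' \<omega> - Z s \<omega>)) I"

text \<open>\<open>dU = a dt + H \<bullet> dX\<close> for \<open>t \<ge> t0\<close>, for a real-valued process \<open>U\<close>. Several driving processes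
  are combined by taking \<open>H\<close> and \<open>X\<close> in a product space.\<close>

definition ito_differential ::
  "'w measure \<Rightarrow> (real \<Rightarrow> 'w measure) \<Rightarrow> real \<Rightarrow> (real \<Rightarrow> 'w \<Rightarrow> real) \<Rightarrow> (real \<Rightarrow> 'w \<Rightarrow> real) \<Rightarrow>
   (real \<Rightarrow> 'w \<Rightarrow> 'a::euclidean_space) \<Rightarrow> (real \<Rightarrow> 'w \<Rightarrow> 'a) \<Rightarrow> bool" where
  "ito_differential M F t0 U a H X \<longleftrightarrow>
     (AE \<omega> in M. continuous_on {t0..} (\<lambda>t. U t \<omega>)) \<and>
     (\<forall>t\<ge>t0. U t \<in> borel_measurable (F t) \<and>
        (AE \<omega> in M. set_integrable lborel {t0..t} (\<lambda>s. a s \<omega>)) \<and>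
        (\<exists>I. ito_integral M F t0 H X t I \<and>
             (AE \<omega> in M. U t \<omega> = U t0 \<omega> + (LINT s:{t0..t}|lborel. a s \<omega>) + I \<omega>)))"

subsection \<open>Signal, measurement and particles\<close>

definition signal_sde ::
  "'w measure \<Rightarrow> (real \<Rightarrow> 'w measure) \<Rightarrow> real \<Rightarrow> (real \<Rightarrow> real ^ 'n \<Rightarrow> real ^ 'n) \<Rightarrow>
   (real \<Rightarrow> real ^ 'n \<Rightarrow> real ^ 'm ^ 'n) \<Rightarrow> (real \<Rightarrow> 'w \<Rightarrow> real ^ 'm) \<Rightarrow> (real \<Rightarrow> 'w \<Rightarrow> real ^ 'n) \<Rightarrow> bool" where
  "signal_sde M F t0 f g \<beta> x \<longleftrightarrow>
     (\<forall>j. ito_differential M F t0 (\<lambda>t \<omega>. x t \<omega> $ j)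
            (\<lambda>t \<omega>. f t (x t \<omega>) $ j) (\<lambda>t \<omega>. g t (x t \<omega>) $ j) \<beta>)"

definition measurement_sde ::
  "'w measure \<Rightarrow> (real \<Rightarrow> 'w measure) \<Rightarrow> real \<Rightarrow> (real \<Rightarrow> real ^ 'n \<Rightarrow> real ^ 'r) \<Rightarrow>
   (real \<Rightarrow> real ^ 'r ^ 'r) \<Rightarrow> (real \<Rightarrow> 'w \<Rightarrow> real ^ 'r) \<Rightarrow> (real \<Rightarrow> 'w \<Rightarrow> real ^ 'n) \<Rightarrow>
   (real \<Rightarrow> 'w \<Rightarrow> real ^ 'r) \<Rightarrow> bool" where
  "measurement_sde M F t0 h R \<eta> x y \<longleftrightarrow>
     (\<forall>a. ito_differential M F t0 (\<lambda>t \<omega>. y t \<omega> $ a)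
            (\<lambda>t \<omega>. h t (x t \<omega>) $ a) (\<lambda>t \<omega>. matrix_sqrt (R t) $ a) \<eta>)"

text \<open>The perturbed innovation \<open>dZ = dy + R^{1/2} d\<eta>\<^sup>i - h(x\<^sup>i) dt\<close> of a particle \<open>\<xi> = x\<^sup>i\<close>.\<close>

definition perturbed_innovation ::
  "'w measure \<Rightarrow> (real \<Rightarrow> 'w measure) \<Rightarrow> real \<Rightarrow> (real \<Rightarrow> real ^ 'n \<Rightarrow> real ^ 'r) \<Rightarrow>
   (real \<Rightarrow> real ^ 'r ^ 'r) \<Rightarrow> (real \<Rightarrow> 'w \<Rightarrow> real ^ 'r) \<Rightarrow> (real \<Rightarrow> 'w \<Rightarrow> real ^ 'r) \<Rightarrow>
   (real \<Rightarrow> 'w \<Rightarrow> real ^ 'n) \<Rightarrow> (real \<Rightarrow> 'w \<Rightarrow> real ^ 'r) \<Rightarrow> bool" where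
  "perturbed_innovation M F t0 h R y \<eta>i \<xi> Z \<longleftrightarrow>
     (\<forall>a. ito_differential M F t0 (\<lambda>t \<omega>. Z t \<omega> $ a)
            (\<lambda>t \<omega>. - (h t (\<xi> t \<omega>) $ a))
            (\<lambda>t \<omega>. (axis a 1, matrix_sqrt (R t) $ a)) (\<lambda>t \<omega>. (y t \<omega>, \<eta>i t \<omega>)))"

text \<open>\<open>d\<xi> = f(\<xi>) dt + g(\<xi>) d\<beta>\<^sup>i + K(\<xi>) \<circ> dZ\<close>\<close>

definition particle_sde ::
  "'w measure \<Rightarrow> (real \<Rightarrow> 'w measure) \<Rightarrow> real \<Rightarrow> (real \<Rightarrow> real ^ 'n \<Rightarrow> real ^ 'n) \<Rightarrow>
   (real \<Rightarrow> real ^ 'n \<Rightarrow> real ^ 'm ^ 'n) \<Rightarrow> (real \<Rightarrow> 'w \<Rightarrow> real ^ 'n \<Rightarrow> real ^ 'r ^ 'n) \<Rightarrow>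
   (real \<Rightarrow> 'w \<Rightarrow> real ^ 'm) \<Rightarrow> (real \<Rightarrow> 'w \<Rightarrow> real ^ 'r) \<Rightarrow> (real \<Rightarrow> 'w \<Rightarrow> real ^ 'n) \<Rightarrow> bool" where
  "particle_sde M F t0 f g K \<beta>i Z \<xi> \<longleftrightarrow>
     (AE \<omega> in M. continuous_on {t0..} (\<lambda>t. \<xi> t \<omega>)) \<and>
     (\<forall>t\<ge>t0. \<xi> t \<in> borel_measurable (F t)) \<and>
     (\<forall>j. \<forall>t\<ge>t0. \<exists>I J.
        (AE \<omega> in M. set_integrable lborel {t0..t} (\<lambda>s. f s (\<xi> s \<omega>) $ j)) \<and>
        ito_integral M F t0 (\<lambda>s \<omega>. g s (\<xi> s \<omega>) $ j) \<beta>i t I \<and>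
        stratonovich_integral M F t0 (\<lambda>s \<omega> z. K s \<omega> z $ j) \<xi> Z t J \<and>
        (AE \<omega> in M. \<xi> t \<omega> $ j =
           \<xi> t0 \<omega> $ j + (LINT s:{t0..t}|lborel. f s (\<xi> s \<omega>) $ j) + I \<omega> + J \<omega>))"

subsection \<open>Gain and Poisson equation\<close>

definition smooth_density :: "(real ^ 'n \<Rightarrow> real ^ 'r) \<Rightarrow> (real ^ 'n \<Rightarrow> real) \<Rightarrow> bool" where
  "smooth_density h p \<longleftrightarrow> C_diff 2 p \<and> (\<forall>x. 0 \<le> p x) \<and>
     integrable lborel p \<and> (LINT x|lborel. p x) = 1 \<and> integrable lborel (\<lambda>x. p x *\<^sub>R h x)"

text \<open>\<open>cond_mean h p\<close> is $\hat h = \int h\,p\,dx$.\<close>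

definition cond_mean :: "(real ^ 'n \<Rightarrow> real ^ 'r) \<Rightarrow> (real ^ 'n \<Rightarrow> real) \<Rightarrow> real ^ 'r" where
  "cond_mean h p = (LINT x|lborel. p x *\<^sub>R h x)"

text \<open>For $r$-dimensional measurements the potential \<open>\<phi>\<close> has $r$ components, and column \<open>a\<close> of the
  gain is $\nabla\phi_a$.\<close>

definition gain :: "(real ^ 'n \<Rightarrow> real ^ 'r) \<Rightarrow> real ^ 'n \<Rightarrow> real ^ 'r ^ 'n" where
  "gain \<phi> x = (\<chi> k a. partial k (\<lambda>z. \<phi> z $ a) x)"

definition poisson_equation ::
  "(real ^ 'n \<Rightarrow> real ^ 'r) \<Rightarrow> real ^ 'r ^ 'r \<Rightarrow> (real ^ 'n \<Rightarrow> real) \<Rightarrow> (real ^ 'n \<Rightarrow> real ^ 'r) \<Rightarrow> bool" where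
  "poisson_equation h R p \<phi> \<longleftrightarrow>
     (\<forall>a. C_diff 3 (\<lambda>x. \<phi> x $ a)) \<and>
     (\<forall>a x. divergence (\<lambda>z. p z *\<^sub>R column a (gain \<phi> z)) x =
        - (p x * ((h x - cond_mean h p) v* matrix_inv R) $ a)) \<and>
     integrable lborel (\<lambda>x. p x *\<^sub>R \<phi> x) \<and> (LINT x|lborel. p x *\<^sub>R \<phi> x) = 0"

subsection \<open>Evolution equations of the posteriors\<close>

text \<open>An evolution equation \<open>dp = A dt + B dy\<close> is given by its drift coefficient \<open>A\<close> and the row
  vector \<open>B\<close> of its \<open>dy\<close> coefficients. All operators act on the functions at a fixed time.\<close>

definition forward_operator ::
  "(real ^ 'n \<Rightarrow> real ^ 'n) \<Rightarrow> (real ^ 'n \<Rightarrow> real ^ 'm ^ 'n) \<Rightarrow> (real ^ 'n \<Rightarrow> real) \<Rightarrow> real ^ 'n \<Rightarrow> real" where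
  "forward_operator f g p x =
     - divergence (\<lambda>z. p z *\<^sub>R f z) x +
     (1/2) * (\<Sum>k\<in>UNIV. \<Sum>l\<in>UNIV.
        partial k (partial l (\<lambda>z. p z * (g z ** transpose (g z)) $ k $ l)) x)"

text \<open>For $r = 1$ this is $q_j = \frac R2 \sum_k K_k \partial K_j / \partial x_k$.\<close>

definition wong_zakai_correction ::
  "real ^ 'r ^ 'r \<Rightarrow> (real ^ 'n \<Rightarrow> real ^ 'r ^ 'n) \<Rightarrow> real ^ 'n \<Rightarrow> real ^ 'n" where
  "wong_zakai_correction R K x =
     (\<chi> j. (1/2) * (\<Sum>k\<in>UNIV. \<Sum>a\<in>UNIV. \<Sum>b\<in>UNIV.
        R $ a $ b * K x $ k $ a * partial k (\<lambda>z. K z $ j $ b) x))"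

definition fpf_drift ::
  "(real ^ 'n \<Rightarrow> real ^ 'n) \<Rightarrow> (real ^ 'n \<Rightarrow> real ^ 'm ^ 'n) \<Rightarrow> (real ^ 'n \<Rightarrow> real ^ 'r) \<Rightarrow>
   real ^ 'r ^ 'r \<Rightarrow> (real ^ 'n \<Rightarrow> real ^ 'r ^ 'n) \<Rightarrow> (real ^ 'n \<Rightarrow> real) \<Rightarrow> real ^ 'n \<Rightarrow> real" where
  "fpf_drift f g h R K p x =
     forward_operator f g p x
     - divergence (\<lambda>z. p z *\<^sub>R (- (K z *v h z) + 2 *\<^sub>R wong_zakai_correction R K z)) x
     + (\<Sum>k\<in>UNIV. \<Sum>l\<in>UNIV.
          partial k (partial l (\<lambda>z. p z * (K z ** R ** transpose (K z)) $ k $ l)) x)"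

definition fpf_dy_coeff ::
  "(real ^ 'n \<Rightarrow> real ^ 'r ^ 'n) \<Rightarrow> (real ^ 'n \<Rightarrow> real) \<Rightarrow> real ^ 'n \<Rightarrow> real ^ 'r" where
  "fpf_dy_coeff K p x = (\<chi> a. - divergence (\<lambda>z. p z *\<^sub>R column a (K z)) x)"

text \<open>The Kushner-Stratonovich equation
  $dp = \mathcal L(p)\,dt + p\,(h - \hat h)^T R^{-1} (dy - \hat h\,dt)$.\<close>

definition ks_dy_coeff ::
  "(real ^ 'n \<Rightarrow> real ^ 'r) \<Rightarrow> real ^ 'r ^ 'r \<Rightarrow> (real ^ 'n \<Rightarrow> real) \<Rightarrow> real ^ 'n \<Rightarrow> real ^ 'r" where
  "ks_dy_coeff h R p x = p x *\<^sub>R ((h x - cond_mean h p) v* matrix_inv R)"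

definition ks_drift ::
  "(real ^ 'n \<Rightarrow> real ^ 'n) \<Rightarrow> (real ^ 'n \<Rightarrow> real ^ 'm ^ 'n) \<Rightarrow> (real ^ 'n \<Rightarrow> real ^ 'r) \<Rightarrow>
   real ^ 'r ^ 'r \<Rightarrow> (real ^ 'n \<Rightarrow> real) \<Rightarrow> real ^ 'n \<Rightarrow> real" where
  "ks_drift f g h R p x = forward_operator f g p x - ks_dy_coeff h R p x \<bullet> cond_mean h p"

definition fpf_evolution ::
  "'w measure \<Rightarrow> (real \<Rightarrow> 'w measure) \<Rightarrow> real \<Rightarrow> (real \<Rightarrow> real ^ 'n \<Rightarrow> real ^ 'n) \<Rightarrow>
   (real \<Rightarrow> real ^ 'n \<Rightarrow> real ^ 'm ^ 'n) \<Rightarrow> (real \<Rightarrow> real ^ 'n \<Rightarrow> real ^ 'r) \<Rightarrow>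
   (real \<Rightarrow> real ^ 'r ^ 'r) \<Rightarrow> (real \<Rightarrow> 'w \<Rightarrow> real ^ 'r) \<Rightarrow>
   (real \<Rightarrow> 'w \<Rightarrow> real ^ 'n \<Rightarrow> real ^ 'r ^ 'n) \<Rightarrow> (real \<Rightarrow> 'w \<Rightarrow> real ^ 'n \<Rightarrow> real) \<Rightarrow> bool" where
  "fpf_evolution M F t0 f g h R y K p \<longleftrightarrow>
     (\<forall>x. ito_differential M F t0 (\<lambda>t \<omega>. p t \<omega> x)
            (\<lambda>t \<omega>. fpf_drift (f t) (g t) (h t) (R t) (K t \<omega>) (p t \<omega>) x)
            (\<lambda>t \<omega>. fpf_dy_coeff (K t \<omega>) (p t \<omega>) x) y)"

definition ks_evolution ::
  "'w measure \<Rightarrow> (real \<Rightarrow> 'w measure) \<Rightarrow> real \<Rightarrow> (real \<Rightarrow> real ^ 'n \<Rightarrow> real ^ 'n) \<Rightarrow>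
   (real \<Rightarrow> real ^ 'n \<Rightarrow> real ^ 'm ^ 'n) \<Rightarrow> (real \<Rightarrow> real ^ 'n \<Rightarrow> real ^ 'r) \<Rightarrow>
   (real \<Rightarrow> real ^ 'r ^ 'r) \<Rightarrow> (real \<Rightarrow> 'w \<Rightarrow> real ^ 'r) \<Rightarrow>
   (real \<Rightarrow> 'w \<Rightarrow> real ^ 'n \<Rightarrow> real) \<Rightarrow> bool" where
  "ks_evolution M F t0 f g h R y p \<longleftrightarrow>
     (\<forall>x. ito_differential M F t0 (\<lambda>t \<omega>. p t \<omega> x)
            (\<lambda>t \<omega>. ks_drift (f t) (g t) (h t) (R t) (p t \<omega>) x)
            (\<lambda>t \<omega>. ks_dy_coeff (h t) (R t) (p t \<omega>) x) y)"

text \<open>Uniqueness for the initial value problem of the Kushner-Stratonovich equation, among random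
  fields of smooth probability densities.\<close>

definition ks_unique ::
  "'w measure \<Rightarrow> (real \<Rightarrow> 'w measure) \<Rightarrow> real \<Rightarrow> (real \<Rightarrow> real ^ 'n \<Rightarrow> real ^ 'n) \<Rightarrow>
   (real \<Rightarrow> real ^ 'n \<Rightarrow> real ^ 'm ^ 'n) \<Rightarrow> (real \<Rightarrow> real ^ 'n \<Rightarrow> real ^ 'r) \<Rightarrow>
   (real \<Rightarrow> real ^ 'r ^ 'r) \<Rightarrow> (real \<Rightarrow> 'w \<Rightarrow> real ^ 'r) \<Rightarrow> bool" where
  "ks_unique M F t0 f g h R y \<longleftrightarrow>
     (\<forall>p1 p2.
        (AE \<omega> in M. \<forall>t\<ge>t0. smooth_density (h t) (p1 t \<omega>) \<and> smooth_density (h t) (p2 t \<omega>)) \<and>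
        ks_evolution M F t0 f g h R y p1 \<and> ks_evolution M F t0 f g h R y p2 \<and>
        (AE \<omega> in M. p1 t0 \<omega> = p2 t0 \<omega>) \<longrightarrow>
        (\<forall>t\<ge>t0. AE \<omega> in M. p1 t \<omega> = p2 t \<omega>))"

end

theory Submission
  imports Defs
begin

section \<open>Calculus of partial derivatives\<close>

text \<open>Both posteriors obey equations of the form \<open>dp = A dt + B dy\<close> driven by the
  same \<open>y\<close>, so exactness reduces to an identity of coefficients, valid for every smooth
  density \<open>p\<close> and every gain \<open>K\<close> whose potential solves the Poisson
  equation for \<open>p\<close>. Write \<open>c\<close> for the conditional mean of
  \<open>h\<close>, \<open>q\<close> for the Wong-Zakai correction and \<open>B\<close> for the row
  \<open>p (h - c)^T R^{-1}\<close>.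

  The \<open>dy\<close> coefficients agree because the Poisson equation says, column by column, that
  \<open>p K\<close> has divergence \<open>-B\<close>. For the drift, take one divergence of
  \<open>p K R K^T\<close>. By the product rule, a derivative falling on the first \<open>K\<close>
  produces \<open>2 p q\<close>, and one falling on \<open>p K\<close> produces
  \<open>-K R B^T = -p K (h - c)\<close> (\<open>row_divergence_KRK\<close>). The sum is
  \<open>p (-K h + 2 q) + p K c\<close>. The second divergence cancels the first summand against the
  transport term of the filter and turns the other into \<open>-B c\<close>, the drift contributed
  by \<open>-c dt\<close> in the true equation (\<open>fpf_drift_eq_ks\<close>).

  Along the random fields the identity holds off a null set. \<open>ito_differential_cong_AE\<close>
  exchanges the coefficients there, with adaptedness supplied by
  \<open>ks_dy_coeff_measurable\<close>, and uniqueness for the true equation then identifies the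
  posteriors.\<close>

lemma partial_eq_derivative:
  assumes "(u has_derivative D) (at x)"
  shows "partial k u x = D (axis k 1)"
proof -
  have "((\<lambda>s. x + s *\<^sub>R axis k 1) has_derivative (\<lambda>s. s *\<^sub>R axis k 1)) (at (0::real))"
    by (auto intro!: derivative_eq_intros)
  moreover have "(u has_derivative D) (at (x + 0 *\<^sub>R axis k 1))"
    using assms by simp
  ultimately have "((\<lambda>s. u (x + s *\<^sub>R axis k 1)) has_derivative (\<lambda>s. D (s *\<^sub>R axis k 1))) (at 0)"
    by (rule has_derivative_compose)
  moreover have "(\<lambda>s. D (s *\<^sub>R axis k 1)) = (*) (D (axis k 1))"
    using has_derivative_linear[OF assms] by (auto simp: linear_cmul)
  ultimately have "((\<lambda>s. u (x + s *\<^sub>R axis k 1)) has_field_derivative D (axis k 1)) (at 0)"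
    by (simp add: has_field_derivative_def)
  then show ?thesis
    unfolding partial_def by (rule DERIV_imp_deriv)
qed

lemma partial_const [simp]: "partial k (\<lambda>z. c) x = 0"
  using partial_eq_derivative[OF has_derivative_const] .

lemma partial_add:
  assumes "u differentiable (at x)" "v differentiable (at x)"
  shows "partial k (\<lambda>z. u z + v z) x = partial k u x + partial k v x"
proof -
  obtain U V where UV: "(u has_derivative U) (at x)" "(v has_derivative V) (at x)"
    using assms by (auto simp: differentiable_def)
  show ?thesis
    using partial_eq_derivative[OF has_derivative_add[OF UV], of k]
      partial_eq_derivative[OF UV(1), of k] partial_eq_derivative[OF UV(2), of k]
    by simp
qed

lemma partial_mult:
  assumes "u differentiable (at x)" "v differentiable (at x)"
  shows "partial k (\<lambda>z. u z * v z) x = partial k u x * v x + u x * partial k v x"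
proof -
  obtain U V where UV: "(u has_derivative U) (at x)" "(v has_derivative V) (at x)"
    using assms by (auto simp: differentiable_def)
  show ?thesis
    using partial_eq_derivative[OF has_derivative_mult[OF UV], of k]
      partial_eq_derivative[OF UV(1), of k] partial_eq_derivative[OF UV(2), of k]
    by simp
qed

lemma partial_cmult:
  assumes "u differentiable (at x)"
  shows "partial k (\<lambda>z. c * u z) x = c * partial k u x"
  using partial_mult[OF differentiable_const assms] by simp

lemma partial_sum:
  assumes "\<And>i. i \<in> I \<Longrightarrow> u i differentiable (at x)"
  shows "partial k (\<lambda>z. \<Sum>i\<in>I. u i z) x = (\<Sum>i\<in>I. partial k (u i) x)"
proof -
  obtain D where D: "\<And>i. i \<in> I \<Longrightarrow> (u i has_derivative D i) (at x)"
    using assms unfolding differentiable_def by metis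
  have "partial k (\<lambda>z. \<Sum>i\<in>I. u i z) x = (\<Sum>i\<in>I. D i (axis k 1))"
    using D by (intro partial_eq_derivative has_derivative_sum)
  also have "\<dots> = (\<Sum>i\<in>I. partial k (u i) x)"
    using partial_eq_derivative[OF D] by simp
  finally show ?thesis .
qed

text \<open>A positive order records continuity only for the top derivatives; at the bottom of the
  induction continuity of \<open>u\<close> comes from its differentiability.\<close>

lemma C_diff_SucD: "C_diff (Suc k) u \<Longrightarrow> C_diff k u"
proof (induction k arbitrary: u)
  case 0
  then show ?case
    by (auto intro!: continuous_at_imp_continuous_on differentiable_imp_continuous_within)
qed auto

lemma C_diff_mono: "C_diff k u \<Longrightarrow> j \<le> k \<Longrightarrow> C_diff j u"
  by (induction k) (auto simp: le_Suc_eq dest: C_diff_SucD simp del: C_diff.simps)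

lemma C_diff_differentiable: "C_diff k u \<Longrightarrow> k \<noteq> 0 \<Longrightarrow> u differentiable (at x)"
  by (cases k) auto

lemma C_diff_const: "C_diff k (\<lambda>z. c)"
  by (induction k arbitrary: c) (auto simp: partial_const[abs_def])

lemma C_diff_add: "C_diff k u \<Longrightarrow> C_diff k v \<Longrightarrow> C_diff k (\<lambda>z. u z + v z)"
proof (induction k arbitrary: u v)
  case 0
  then show ?case by (simp add: continuous_on_add)
next
  case (Suc k)
  have "partial j (\<lambda>z. u z + v z) = (\<lambda>z. partial j u z + partial j v z)" for j
    using Suc.prems by (intro ext partial_add) auto
  then show ?case
    using Suc by simp
qed

lemma C_diff_mult: "C_diff k u \<Longrightarrow> C_diff k v \<Longrightarrow> C_diff k (\<lambda>z. u z * v z)"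
proof (induction k arbitrary: u v)
  case 0
  then show ?case by (simp add: continuous_on_mult)
next
  case (Suc k)
  have "C_diff k (\<lambda>z. partial j u z * v z + u z * partial j v z)" for j
    using Suc.prems C_diff_SucD[OF Suc.prems(1)] C_diff_SucD[OF Suc.prems(2)]
    by (intro C_diff_add Suc.IH) auto
  moreover have "partial j (\<lambda>z. u z * v z) = (\<lambda>z. partial j u z * v z + u z * partial j v z)" for j
    using Suc.prems by (intro ext partial_mult) auto
  ultimately show ?case
    using Suc.prems by simp
qed

lemma C_diff_sum: "(\<And>i. i \<in> I \<Longrightarrow> C_diff k (u i)) \<Longrightarrow> C_diff k (\<lambda>z. \<Sum>i\<in>I. u i z)"
  by (induction I rule: infinite_finite_induct) (auto intro: C_diff_const C_diff_add)

section \<open>Coefficients of the filter equation\<close>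

lemma divergence_scaled_column:
  "divergence (\<lambda>z. p z *\<^sub>R column a (K z)) x = (\<Sum>k\<in>UNIV. partial k (\<lambda>z. p z * K z $ k $ a) x)"
  by (simp add: divergence_def column_def)

lemma KRK_entry:
  fixes K :: "real ^ 'r ^ 'n"
  shows "(K ** R ** transpose K) $ k $ l = (\<Sum>a\<in>UNIV. \<Sum>b\<in>UNIV. R $ a $ b * (K $ k $ a * K $ l $ b))"
proof -
  have "(K ** R ** transpose K) $ k $ l = (\<Sum>b\<in>UNIV. \<Sum>a\<in>UNIV. R $ a $ b * (K $ k $ a * K $ l $ b))"
    by (simp add: matrix_matrix_mult_def transpose_def sum_distrib_left sum_distrib_right mult_ac)
  then show ?thesis
    by (subst sum.swap)
qed

text \<open>The product rule is applied to \<open>K_ka\<close> times \<open>p K_lb\<close>. Keeping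
  \<open>p\<close> with the second factor makes the divergence of \<open>p K_b\<close> appear, which
  is the quantity the Poisson equation determines.\<close>

lemma row_divergence_KRK:
  fixes K :: "real ^ 'n \<Rightarrow> real ^ 'r ^ 'n"
  assumes p: "p differentiable (at x)"
    and K: "\<And>k a. (\<lambda>z. K z $ k $ a) differentiable (at x)"
    and R: "transpose R = R"
  shows "(\<Sum>l\<in>UNIV. partial l (\<lambda>z. p z * (K z ** R ** transpose (K z)) $ k $ l) x) =
    2 * p x * wong_zakai_correction R K x $ k +
    (\<Sum>a\<in>UNIV. K x $ k $ a *
      (\<Sum>b\<in>UNIV. R $ a $ b * divergence (\<lambda>z. p z *\<^sub>R column b (K z)) x))"
proof -
  have R': "R $ a $ b = R $ b $ a" for a b
    by (metis R transpose_def vec_lambda_beta)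
  have entry: "p z * (K z ** R ** transpose (K z)) $ k $ l =
      (\<Sum>a\<in>UNIV. \<Sum>b\<in>UNIV. R $ a $ b * (K z $ k $ a * (p z * K z $ l $ b)))" for z l
    by (simp add: KRK_entry sum_distrib_left mult_ac)
  have "partial l (\<lambda>z. p z * (K z ** R ** transpose (K z)) $ k $ l) x =
      (\<Sum>a\<in>UNIV. \<Sum>b\<in>UNIV. R $ a $ b *
        (partial l (\<lambda>z. K z $ k $ a) x * (p x * K x $ l $ b) +
         K x $ k $ a * partial l (\<lambda>z. p z * K z $ l $ b) x))" for l
    unfolding entry
    by (simp add: partial_sum partial_cmult partial_mult p K)
  then have "(\<Sum>l\<in>UNIV. partial l (\<lambda>z. p z * (K z ** R ** transpose (K z)) $ k $ l) x) =
      (\<Sum>l\<in>UNIV. \<Sum>a\<in>UNIV. \<Sum>b\<in>UNIV. R $ a $ b *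
        (partial l (\<lambda>z. K z $ k $ a) x * (p x * K x $ l $ b))) +
      (\<Sum>l\<in>UNIV. \<Sum>a\<in>UNIV. \<Sum>b\<in>UNIV. R $ a $ b *
        (K x $ k $ a * partial l (\<lambda>z. p z * K z $ l $ b) x))"
    by (simp add: distrib_left sum.distrib)
  \<comment> \<open>In \<open>wong_zakai_correction\<close> the differentiated factor carries the
    second index of \<open>R\<close>, here the first; symmetry of \<open>R\<close> reconciles the
    two.\<close>
  also have "(\<Sum>l\<in>UNIV. \<Sum>a\<in>UNIV. \<Sum>b\<in>UNIV. R $ a $ b *
        (partial l (\<lambda>z. K z $ k $ a) x * (p x * K x $ l $ b))) =
      (\<Sum>l\<in>UNIV. \<Sum>b\<in>UNIV. \<Sum>a\<in>UNIV. R $ b $ a *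
        (partial l (\<lambda>z. K z $ k $ a) x * (p x * K x $ l $ b)))"
    by (subst (2) sum.swap) (simp only: R')
  also have "\<dots> = 2 * p x * wong_zakai_correction R K x $ k"
    by (simp add: wong_zakai_correction_def sum_distrib_left mult_ac)
  also have "(\<Sum>l\<in>UNIV. \<Sum>a\<in>UNIV. \<Sum>b\<in>UNIV. R $ a $ b *
        (K x $ k $ a * partial l (\<lambda>z. p z * K z $ l $ b) x)) =
      (\<Sum>a\<in>UNIV. \<Sum>b\<in>UNIV. \<Sum>l\<in>UNIV. R $ a $ b *
        (K x $ k $ a * partial l (\<lambda>z. p z * K z $ l $ b) x))"
    by (subst sum.swap, intro sum.cong refl, subst sum.swap, rule refl)
  also have "\<dots> = (\<Sum>a\<in>UNIV. K x $ k $ a *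
      (\<Sum>b\<in>UNIV. R $ a $ b * divergence (\<lambda>z. p z *\<^sub>R column b (K z)) x))"
    by (simp add: divergence_scaled_column sum_distrib_left mult_ac)
  finally show ?thesis .
qed

text \<open>\<open>matrix_inv\<close> is a choice among two-sided inverses, so one must exist:
  positive definiteness gives a trivial kernel, hence a left inverse, which for a square matrix is
  two-sided.\<close>

lemma positive_definite_matrix_inv:
  assumes "positive_definite R"
  shows "matrix_inv R ** R = mat 1"
proof -
  have "v = 0" if "R *v v = 0" for v
    using assms that by (force simp: positive_definite_def)
  then obtain B where "B ** R = mat 1"
    using matrix_left_invertible_ker by blast
  then have "\<exists>B. R ** B = mat 1 \<and> B ** R = mat 1"
    using matrix_left_right_inverse by blast
  then show ?thesis
    unfolding matrix_inv_def by (rule someI2_ex) simp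
qed

lemma fpf_dy_coeff_eq_ks:
  assumes "poisson_equation h R p \<psi>"
  shows "fpf_dy_coeff (gain \<psi>) p x = ks_dy_coeff h R p x"
  using assms by (simp add: vec_eq_iff fpf_dy_coeff_def ks_dy_coeff_def poisson_equation_def)

text \<open>The second-order term is the divergence of the vector field computed in \<open>row_divergence_KRK\<close>.
  Since \<open>K\<close> solves the Poisson equation, this field is \<open>p (2 q - K (h - c))\<close> with the conditional
  mean \<open>c\<close>; it cancels the drift field \<open>p (- K h + 2 q)\<close> up to \<open>p K c\<close>, whose divergence is again
  known from the Poisson equation.\<close>

lemma fpf_drift_eq_ks:
  fixes h :: "real ^ 'n \<Rightarrow> real ^ 'r"
  assumes h: "\<And>a. C_diff 1 (\<lambda>z. h z $ a)" and R: "positive_definite R"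
    and p: "C_diff 2 p" and poisson: "poisson_equation h R p \<psi>"
  shows "fpf_drift f g h R (gain \<psi>) p x = ks_drift f g h R p x"
proof -
  define K where "K = gain \<psi>"
  define c where "c = cond_mean h p"
  define q where "q = wong_zakai_correction R K"
  define B where "B = ks_dy_coeff h R p"
  have tR: "transpose R = R"
    using R by (simp add: positive_definite_def)
  then have R': "R $ a $ b = R $ b $ a" for a b
    by (metis transpose_def vec_lambda_beta)
  \<comment> \<open>Three derivatives of the potential make \<open>K\<close> twice and
    \<open>q\<close> once continuously differentiable, as the second-order term and the divergence
    of \<open>p q\<close> require.\<close>
  have "C_diff 3 (\<lambda>z. \<psi> z $ a)" for a
    using poisson by (simp add: poisson_equation_def)
  then have K2: "C_diff 2 (\<lambda>z. K z $ k $ a)" for k a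
    by (simp add: K_def gain_def numeral_3_eq_3 numeral_2_eq_2)
  have K1: "C_diff 1 (\<lambda>z. K z $ k $ a)" for k a
    by (rule C_diff_mono[OF K2]) simp
  have dK: "C_diff 1 (partial l (\<lambda>z. K z $ k $ a))" for k l a
    using K2[of k a] by (simp add: numeral_2_eq_2)
  have p1: "C_diff 1 p"
    by (rule C_diff_mono[OF p]) simp
  have div_pK: "divergence (\<lambda>z. p z *\<^sub>R column a (K z)) z = - B z $ a" for a z
    using poisson by (simp add: poisson_equation_def K_def B_def ks_dy_coeff_def)
  \<comment> \<open>Multiplying \<open>B\<close> by \<open>R\<close> from the right undoes the
    inverse; symmetry of \<open>R\<close> turns this row product into a sum over row
    \<open>a\<close>.\<close>
  have BR: "(\<Sum>b\<in>UNIV. R $ a $ b * B z $ b) = p z * (h z $ a - c $ a)" for a z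
  proof -
    have "B z v* R = p z *\<^sub>R (h z - c)"
      by (simp add: B_def c_def ks_dy_coeff_def scaleR_vector_matrix_assoc vector_matrix_mul_assoc
          positive_definite_matrix_inv[OF R])
    then have "(B z v* R) $ a = p z * (h z $ a - c $ a)"
      by simp
    then show ?thesis
      by (simp add: vector_matrix_mult_def R'[of a] mult.commute)
  qed
  have q1: "C_diff 1 (\<lambda>z. q z $ k)" for k
    unfolding q_def wong_zakai_correction_def vec_lambda_beta
    by (intro C_diff_mult C_diff_sum C_diff_const K1 dK)
  have "C_diff 2 (\<lambda>z. p z * (K z ** R ** transpose (K z)) $ k $ l)" for k l
    unfolding KRK_entry by (intro C_diff_mult C_diff_sum C_diff_const p K2)
  then have dA: "partial l (\<lambda>z. p z * (K z ** R ** transpose (K z)) $ k $ l) differentiable (at x)" for k l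
    by (auto simp: numeral_2_eq_2)
  define V where "V = (\<lambda>z k. p z * (- (\<Sum>a\<in>UNIV. K z $ k $ a * h z $ a) + 2 * q z $ k))"
  define W where "W = (\<lambda>z k. \<Sum>a\<in>UNIV. c $ a * (p z * K z $ k $ a))"
  have V: "(\<lambda>z. V z k) differentiable (at x)" for k
  proof -
    \<comment> \<open>The minus sign becomes a constant factor, so that closure of
      \<open>C_diff\<close> under sums and products suffices.\<close>
    have "V = (\<lambda>z k. p z * ((-1) * (\<Sum>a\<in>UNIV. K z $ k $ a * h z $ a) + 2 * q z $ k))"
      by (simp add: V_def)
    then have "C_diff 1 (\<lambda>z. V z k)"
      by (simp only:) (intro C_diff_mult C_diff_add C_diff_sum C_diff_const p1 K1 h q1)
    then show ?thesis
      by (rule C_diff_differentiable) simp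
  qed
  have W: "(\<lambda>z. W z k) differentiable (at x)" for k
    unfolding W_def
    by (rule C_diff_differentiable[where k = 1], intro C_diff_mult C_diff_sum C_diff_const p1 K1) simp
  \<comment> \<open>Stated at every \<open>z\<close>, not only at \<open>x\<close>, since both sides
    are differentiated once more.\<close>
  have row: "(\<Sum>l\<in>UNIV. partial l (\<lambda>z. p z * (K z ** R ** transpose (K z)) $ k $ l) z) = V z k + W z k" for k z
  proof -
    have "(\<Sum>l\<in>UNIV. partial l (\<lambda>z. p z * (K z ** R ** transpose (K z)) $ k $ l) z) =
        2 * p z * q z $ k + (\<Sum>a\<in>UNIV. K z $ k $ a * (\<Sum>b\<in>UNIV. R $ a $ b * - B z $ b))"
      unfolding div_pK[symmetric] q_def
      using p1 K1 tR by (intro row_divergence_KRK) auto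
    also have "\<dots> = 2 * p z * q z $ k - (\<Sum>a\<in>UNIV. K z $ k $ a * (p z * (h z $ a - c $ a)))"
      by (simp add: sum_negf BR)
    also have "\<dots> = V z k + W z k"
      by (simp add: V_def W_def algebra_simps sum_subtractf sum_distrib_left)
    finally show ?thesis .
  qed
  have "(\<Sum>k\<in>UNIV. \<Sum>l\<in>UNIV. partial k (partial l (\<lambda>z. p z * (K z ** R ** transpose (K z)) $ k $ l)) x) =
      (\<Sum>k\<in>UNIV. partial k (\<lambda>z. V z k + W z k) x)"
    by (simp add: row[symmetric] partial_sum dA)
  also have "\<dots> = (\<Sum>k\<in>UNIV. partial k (\<lambda>z. V z k) x) + (\<Sum>k\<in>UNIV. partial k (\<lambda>z. W z k) x)"
    by (simp add: partial_add V W sum.distrib)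
  also have "(\<Sum>k\<in>UNIV. partial k (\<lambda>z. V z k) x) =
      divergence (\<lambda>z. p z *\<^sub>R (- (K z *v h z) + 2 *\<^sub>R q z)) x"
    by (simp add: divergence_def V_def matrix_vector_mult_def)
  also have "(\<Sum>k\<in>UNIV. partial k (\<lambda>z. W z k) x) = - (B x \<bullet> c)"
  proof -
    have "(\<lambda>z. p z * K z $ k $ a) differentiable (at x)" for k a
      by (rule C_diff_differentiable[OF C_diff_mult[OF p1 K1]]) simp
    then have "(\<Sum>k\<in>UNIV. partial k (\<lambda>z. W z k) x) =
        (\<Sum>k\<in>UNIV. \<Sum>a\<in>UNIV. c $ a * partial k (\<lambda>z. p z * K z $ k $ a) x)"
      by (simp add: W_def partial_sum partial_cmult)
    also have "\<dots> = (\<Sum>a\<in>UNIV. c $ a * divergence (\<lambda>z. p z *\<^sub>R column a (K z)) x)"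
      by (subst sum.swap) (simp add: divergence_scaled_column sum_distrib_left)
    finally show ?thesis
      by (simp add: div_pK inner_vec_def sum_negf mult.commute)
  qed
  finally show ?thesis
    by (simp add: fpf_drift_def ks_drift_def K_def q_def B_def c_def)
qed

section \<open>Change of coefficients on a null set\<close>

text \<open>The filtration is not assumed to contain the null sets, so adaptedness of an integrand does not
  survive a change on a null set and is proved for the new integrand directly, through joint
  measurability of the conditional density.\<close>

lemma partition_of_nth:
  assumes "partition_of t0 t ts" "k < length ts"
  shows "t0 \<le> ts ! k" "ts ! k \<le> t"
  using assms by (auto simp: partition_of_def hd_conv_nth last_conv_nth sorted_iff_nth_mono)

text \<open>For each partition the two sums agree almost surely, so the deviation events have equal
  probability and the same \<open>\<delta>\<close> works. Measurability of the new summands is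
  assumed because equality off a null set does not provide it.\<close>

lemma riemann_limit_cong_AE:
  assumes I: "riemann_limit M t0 t D I"
    and D': "\<And>s s'. t0 \<le> s \<Longrightarrow> s \<le> s' \<Longrightarrow> s' \<le> t \<Longrightarrow> D' s s' \<in> borel_measurable M"
    and eq: "AE \<omega> in M. \<forall>s s'. t0 \<le> s \<and> s \<le> s' \<and> s' \<le> t \<longrightarrow> D s s' \<omega> = D' s s' \<omega>"
  shows "riemann_limit M t0 t D' I"
proof -
  have *: "measure M {\<omega> \<in> space M. \<epsilon> < \<bar>(\<Sum>k < length ts - 1. D (ts ! k) (ts ! Suc k) \<omega>) - I \<omega>\<bar>} =
      measure M {\<omega> \<in> space M. \<epsilon> < \<bar>(\<Sum>k < length ts - 1. D' (ts ! k) (ts ! Suc k) \<omega>) - I \<omega>\<bar>}"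
    if "partition_of t0 t ts" for ts \<epsilon>
  proof -
    have ts: "t0 \<le> ts ! k" "ts ! k \<le> ts ! Suc k" "ts ! Suc k \<le> t" if "k < length ts - 1" for k
      using \<open>partition_of t0 t ts\<close> that partition_of_nth[of t0 t ts]
      by (auto simp: partition_of_def sorted_iff_nth_mono)
    have [measurable]: "I \<in> borel_measurable M"
      and D: "\<And>s s'. t0 \<le> s \<Longrightarrow> s \<le> s' \<Longrightarrow> s' \<le> t \<Longrightarrow> D s s' \<in> borel_measurable M"
      using I by (auto simp: riemann_limit_def)
    define S where "S = (\<lambda>\<omega>. \<Sum>k < length ts - 1. D (ts ! k) (ts ! Suc k) \<omega>)"
    define S' where "S' = (\<lambda>\<omega>. \<Sum>k < length ts - 1. D' (ts ! k) (ts ! Suc k) \<omega>)"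
    have [measurable]: "S \<in> borel_measurable M" "S' \<in> borel_measurable M"
      unfolding S_def S'_def using ts D D' by (auto intro!: borel_measurable_sum)
    have "AE \<omega> in M. S \<omega> = S' \<omega>"
      unfolding S_def S'_def using eq by eventually_elim (auto intro!: sum.cong simp: ts)
    then have "measure M {\<omega> \<in> space M. \<epsilon> < \<bar>S \<omega> - I \<omega>\<bar>} = measure M {\<omega> \<in> space M. \<epsilon> < \<bar>S' \<omega> - I \<omega>\<bar>}"
      by (intro measure_eq_AE) auto
    then show ?thesis
      by (simp only: S_def S'_def)
  qed
  show ?thesis
    unfolding riemann_limit_def
  proof (intro conjI allI impI)
    fix \<epsilon> :: real assume "\<epsilon> > 0"
    then obtain \<delta> where "\<delta> > 0" and \<delta>: "\<And>ts. partition_of t0 t ts \<Longrightarrow>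
        \<forall>k < length ts - 1. ts ! Suc k - ts ! k < \<delta> \<Longrightarrow>
        measure M {\<omega> \<in> space M. \<epsilon> < \<bar>(\<Sum>k < length ts - 1. D (ts ! k) (ts ! Suc k) \<omega>) - I \<omega>\<bar>} < \<epsilon>"
      using I unfolding riemann_limit_def by meson
    show "\<exists>\<delta>>0. \<forall>ts. partition_of t0 t ts \<and> (\<forall>k < length ts - 1. ts ! Suc k - ts ! k < \<delta>) \<longrightarrow>
        measure M {\<omega> \<in> space M. \<epsilon> < \<bar>(\<Sum>k < length ts - 1. D' (ts ! k) (ts ! Suc k) \<omega>) - I \<omega>\<bar>} < \<epsilon>"
    proof (intro exI[of _ \<delta>] conjI allI impI \<open>\<delta> > 0\<close>)
      fix ts
      assume ts: "partition_of t0 t ts \<and> (\<forall>k < length ts - 1. ts ! Suc k - ts ! k < \<delta>)"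
      show "measure M {\<omega> \<in> space M. \<epsilon> < \<bar>(\<Sum>k < length ts - 1. D' (ts ! k) (ts ! Suc k) \<omega>) - I \<omega>\<bar>} < \<epsilon>"
        using \<delta>[OF conjunct1[OF ts] conjunct2[OF ts]] by (simp only: *[OF conjunct1[OF ts]])
    qed
  qed (use I D' in \<open>auto simp: riemann_limit_def\<close>)
qed

text \<open>One null set serves all times, so off it whole coefficient paths coincide: continuity,
  integrability and the \<open>dt\<close> integral carry over, and the same random variable remains
  the stochastic integral.\<close>

lemma ito_differential_cong_AE:
  assumes U: "ito_differential M F t0 U a H X"
    and sub: "\<And>t. subalgebra M (F t)"
    and H': "\<And>t. t \<ge> t0 \<Longrightarrow> H' t \<in> borel_measurable (F t)"
    and eq: "AE \<omega> in M. \<forall>t\<ge>t0. a t \<omega> = a' t \<omega> \<and> H t \<omega> = H' t \<omega>"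
  shows "ito_differential M F t0 U a' H' X"
proof -
  have int: "AE \<omega> in M. set_integrable lborel {t0..t} (\<lambda>s. a' s \<omega>)"
    if "AE \<omega> in M. set_integrable lborel {t0..t} (\<lambda>s. a s \<omega>)" for t
    using that eq
  proof eventually_elim
    case (elim \<omega>)
    then show ?case
      by (subst set_integrable_cong[where f' = "\<lambda>s. a s \<omega>"]) auto
  qed
  have ito: "ito_integral M F t0 H' X t I" if I: "ito_integral M F t0 H X t I" for t I
  proof -
    have XF: "\<And>s. s \<in> {t0..t} \<Longrightarrow> X s \<in> borel_measurable (F s)"
      using I by (simp add: ito_integral_def)
    have "AE \<omega> in M. continuous_on {t0..t} (\<lambda>s. H s \<omega>) \<and> continuous_on {t0..t} (\<lambda>s. X s \<omega>)"
      using I by (simp add: ito_integral_def)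
    with eq have "AE \<omega> in M. continuous_on {t0..t} (\<lambda>s. H' s \<omega>) \<and> continuous_on {t0..t} (\<lambda>s. X s \<omega>)"
      by eventually_elim (auto elim!: continuous_on_eq)
    moreover have "riemann_limit M t0 t (\<lambda>s s' \<omega>. H' s \<omega> \<bullet> (X s' \<omega> - X s \<omega>)) I"
    proof (rule riemann_limit_cong_AE)
      show "riemann_limit M t0 t (\<lambda>s s' \<omega>. H s \<omega> \<bullet> (X s' \<omega> - X s \<omega>)) I"
        using I by (simp add: ito_integral_def)
      show "(\<lambda>\<omega>. H' s \<omega> \<bullet> (X s' \<omega> - X s \<omega>)) \<in> borel_measurable M"
        if "t0 \<le> s" "s \<le> s'" "s' \<le> t" for s s'
        using that measurable_from_subalg[OF sub H'[of s]]
          measurable_from_subalg[OF sub XF[of s]] measurable_from_subalg[OF sub XF[of s']]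
        by (intro borel_measurable_inner borel_measurable_diff) auto
      show "AE \<omega> in M. \<forall>s s'. t0 \<le> s \<and> s \<le> s' \<and> s' \<le> t \<longrightarrow>
          H s \<omega> \<bullet> (X s' \<omega> - X s \<omega>) = H' s \<omega> \<bullet> (X s' \<omega> - X s \<omega>)"
        using eq by eventually_elim simp
    qed
    ultimately show ?thesis
      using H' XF by (simp add: ito_integral_def)
  qed
  have drift: "AE \<omega> in M. U t \<omega> = U t0 \<omega> + (LINT s:{t0..t}|lborel. a' s \<omega>) + I \<omega>"
    if "AE \<omega> in M. U t \<omega> = U t0 \<omega> + (LINT s:{t0..t}|lborel. a s \<omega>) + I \<omega>" for t I
    using that eq
  proof eventually_elim
    case (elim \<omega>)
    have "(LINT s:{t0..t}|lborel. a' s \<omega>) = (LINT s:{t0..t}|lborel. a s \<omega>)"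
      using elim by (intro set_lebesgue_integral_cong) auto
    then show ?case
      using elim by simp
  qed
  show ?thesis
    using U int ito drift unfolding ito_differential_def by blast
qed

section \<open>Adaptedness of the coefficients of the true equation\<close>

text \<open>Expresses that \<open>G\<close> contains the history of \<open>X\<close> as
  measurability of the identity, the form in which a density jointly measurable for the history can
  be pulled back to \<open>G\<close>.\<close>

lemma measurable_ident_generated_sigma:
  assumes space: "space G = space M" and X: "\<And>s. s \<in> T \<Longrightarrow> X s \<in> borel_measurable G"
  shows "(\<lambda>\<omega>. \<omega>) \<in> measurable G (generated_sigma M T X)"
  unfolding generated_sigma_def
proof (rule measurable_measure_of)
  fix A assume "A \<in> (\<Union>s\<in>T. {X s -` A \<inter> space M | A. A \<in> sets borel})"
  then show "(\<lambda>\<omega>. \<omega>) -` A \<inter> space G \<in> sets G"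
    using measurable_sets[OF X] by (auto simp: space)
qed (auto simp: space)

lemma cond_mean_measurable:
  assumes p: "(\<lambda>(\<omega>, x). p \<omega> x) \<in> borel_measurable (G \<Otimes>\<^sub>M borel)"
    and h: "h \<in> borel_measurable borel"
  shows "(\<lambda>\<omega>. cond_mean h (p \<omega>)) \<in> borel_measurable G"
proof -
  have "(\<lambda>(\<omega>, x). p \<omega> x *\<^sub>R h x) \<in> borel_measurable (G \<Otimes>\<^sub>M lborel)"
    using p h by (simp add: split_beta')
  then show ?thesis
    unfolding cond_mean_def by (intro lborel.borel_measurable_lebesgue_integral)
qed

lemma ks_dy_coeff_measurable:
  assumes p: "(\<lambda>(\<omega>, x). p \<omega> x) \<in> borel_measurable (G \<Otimes>\<^sub>M borel)"
    and h: "h \<in> borel_measurable borel"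
  shows "(\<lambda>\<omega>. ks_dy_coeff h R (p \<omega>) x) \<in> borel_measurable G"
proof -
  \<comment> \<open>Row multiplication by \<open>matrix_inv R\<close>, written as a linear and hence
    continuous map on column vectors.\<close>
  have "(\<lambda>v. transpose (matrix_inv R) *v v) \<in> borel_measurable borel"
    by (intro borel_measurable_continuous_onI matrix_vector_mult_linear_continuous_on)
  then have "(\<lambda>\<omega>. (h x - cond_mean h (p \<omega>)) v* matrix_inv R) \<in> borel_measurable G"
    using cond_mean_measurable[OF p h] by (simp add: measurable_compose)
  moreover have "(\<lambda>\<omega>. p \<omega> x) \<in> borel_measurable G"
    using measurable_compose[OF measurable_Pair2'[of x borel G] p] p by simp
  ultimately show ?thesis
    unfolding ks_dy_coeff_def by simp
qed

section \<open>Agreement of the evolution equations and of the posteriors\<close>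

theorem theorem2p1:
  fixes M :: "'w measure" and F :: "real \<Rightarrow> 'w measure" and t0 :: real and N :: nat
    and f :: "real \<Rightarrow> real ^ 'n \<Rightarrow> real ^ 'n"
    and g :: "real \<Rightarrow> real ^ 'n \<Rightarrow> real ^ 'm ^ 'n"
    and h :: "real \<Rightarrow> real ^ 'n \<Rightarrow> real ^ 'r"
    and R :: "real \<Rightarrow> real ^ 'r ^ 'r"
    and \<beta> :: "real \<Rightarrow> 'w \<Rightarrow> real ^ 'm" and \<eta> :: "real \<Rightarrow> 'w \<Rightarrow> real ^ 'r"
    and x :: "real \<Rightarrow> 'w \<Rightarrow> real ^ 'n" and y :: "real \<Rightarrow> 'w \<Rightarrow> real ^ 'r"
    and \<beta>p :: "nat \<Rightarrow> real \<Rightarrow> 'w \<Rightarrow> real ^ 'm" and \<eta>p :: "nat \<Rightarrow> real \<Rightarrow> 'w \<Rightarrow> real ^ 'r"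
    and Z :: "nat \<Rightarrow> real \<Rightarrow> 'w \<Rightarrow> real ^ 'r" and xp :: "nat \<Rightarrow> real \<Rightarrow> 'w \<Rightarrow> real ^ 'n"
    and \<phi> :: "real \<Rightarrow> 'w \<Rightarrow> real ^ 'n \<Rightarrow> real ^ 'r"
    and \<pi> \<pi>s :: "real \<Rightarrow> 'w \<Rightarrow> real ^ 'n \<Rightarrow> real"
  assumes "prob_space M" and "filtration (space M) F" and "\<And>t. subalgebra M (F t)"
    and "N \<ge> 1"
    \<comment> \<open>coefficients\<close>
    and "continuous_on ({t0..} \<times> UNIV) (\<lambda>(t, z). f t z)"
    and "continuous_on ({t0..} \<times> UNIV) (\<lambda>(t, z). g t z)"
    and "continuous_on ({t0..} \<times> UNIV) (\<lambda>(t, z). h t z)"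
    and "\<And>t j. t \<ge> t0 \<Longrightarrow> C_diff 1 (\<lambda>z. f t z $ j)"
    and "\<And>t j b. t \<ge> t0 \<Longrightarrow> C_diff 2 (\<lambda>z. g t z $ j $ b)"
    and "\<And>t a. t \<ge> t0 \<Longrightarrow> C_diff 1 (\<lambda>z. h t z $ a)"
    and "continuous_on {t0..} R" and "\<And>t. t \<ge> t0 \<Longrightarrow> positive_definite (R t)"
    \<comment> \<open>independent Brownian motions\<close>
    and "brownian_motion M F t0 \<beta>" and "brownian_motion M F t0 \<eta>"
    and "\<And>i. i \<in> {1..N} \<Longrightarrow> brownian_motion M F t0 (\<beta>p i)"
    and "\<And>i. i \<in> {1..N} \<Longrightarrow> brownian_motion M F t0 (\<eta>p i)"
    and "prob_space.indep_sets M
           (\<lambda>c. sets (case c of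
               Signal_Noise \<Rightarrow> generated_sigma M {t0..} \<beta>
             | Measurement_Noise \<Rightarrow> generated_sigma M {t0..} \<eta>
             | Particle_Signal_Noise i \<Rightarrow> generated_sigma M {t0..} (\<beta>p i)
             | Particle_Measurement_Noise i \<Rightarrow> generated_sigma M {t0..} (\<eta>p i)))
           ({Signal_Noise, Measurement_Noise} \<union>
            Particle_Signal_Noise ` {1..N} \<union> Particle_Measurement_Noise ` {1..N})"
    \<comment> \<open>signal and measurement, true posterior\<close>
    and "signal_sde M F t0 f g \<beta> x"
    and "measurement_sde M F t0 h R \<eta> x y"
    and "\<And>t. t \<ge> t0 \<Longrightarrow>
           conditional_density M (generated_sigma M {t0..t} y) (x t) (\<lambda>\<omega>. \<pi>s t \<omega>)"
    and "AE \<omega> in M. \<forall>t\<ge>t0. smooth_density (h t) (\<pi>s t \<omega>)"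
    \<comment> \<open>feedback particle filter, filter posterior\<close>
    and "\<And>i. i \<in> {1..N} \<Longrightarrow> perturbed_innovation M F t0 h R y (\<eta>p i) (xp i) (Z i)"
    and "\<And>i. i \<in> {1..N} \<Longrightarrow>
           particle_sde M F t0 f g (\<lambda>t \<omega>. gain (\<phi> t \<omega>)) (\<beta>p i) (Z i) (xp i)"
    and "\<And>t i. t \<ge> t0 \<Longrightarrow> i \<in> {1..N} \<Longrightarrow>
           conditional_density M (generated_sigma M {t0..t} y) (xp i t) (\<lambda>\<omega>. \<pi> t \<omega>)"
    and "AE \<omega> in M. \<forall>t\<ge>t0. smooth_density (h t) (\<pi> t \<omega>)"
    and "AE \<omega> in M. \<forall>t\<ge>t0. poisson_equation (h t) (R t) (\<pi> t \<omega>) (\<phi> t \<omega>)"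
    \<comment> \<open>evolution of the two posteriors\<close>
    and "fpf_evolution M F t0 f g h R y (\<lambda>t \<omega>. gain (\<phi> t \<omega>)) \<pi>"
    and "ks_evolution M F t0 f g h R y \<pi>s"
    \<comment> \<open>equal initial posteriors\<close>
    and "AE \<omega> in M. \<pi> t0 \<omega> = \<pi>s t0 \<omega>"
  shows
    \<comment> \<open>the evolution equations of the two posteriors have the same coefficients\<close>
    "(\<forall>t\<ge>t0. \<forall>p \<psi>. smooth_density (h t) p \<and> poisson_equation (h t) (R t) p \<psi> \<longrightarrow>
        (\<forall>z. fpf_drift (f t) (g t) (h t) (R t) (gain \<psi>) p z = ks_drift (f t) (g t) (h t) (R t) p z \<and>
             fpf_dy_coeff (gain \<psi>) p z = ks_dy_coeff (h t) (R t) p z))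
     \<comment> \<open>the filter posterior obeys the evolution equation of the true posterior\<close>
     \<and> ks_evolution M F t0 f g h R y \<pi>
     \<comment> \<open>the posteriors coincide whenever this equation determines its solution\<close>
     \<and> (ks_unique M F t0 f g h R y \<longrightarrow> (\<forall>t\<ge>t0. AE \<omega> in M. \<pi> t \<omega> = \<pi>s t \<omega>))"
proof -
  have coeffs: "fpf_drift (f t) (g t) (h t) (R t) (gain \<psi>) p z = ks_drift (f t) (g t) (h t) (R t) p z \<and>
      fpf_dy_coeff (gain \<psi>) p z = ks_dy_coeff (h t) (R t) p z"
    if "t \<ge> t0" "smooth_density (h t) p" "poisson_equation (h t) (R t) p \<psi>" for t p \<psi> z
    using that assms(10,12)[OF that(1)]
    by (auto simp: smooth_density_def intro!: fpf_drift_eq_ks fpf_dy_coeff_eq_ks)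
  have fpf: "ito_differential M F t0 (\<lambda>t \<omega>. \<pi> t \<omega> z)
      (\<lambda>t \<omega>. fpf_drift (f t) (g t) (h t) (R t) (gain (\<phi> t \<omega>)) (\<pi> t \<omega>) z)
      (\<lambda>t \<omega>. fpf_dy_coeff (gain (\<phi> t \<omega>)) (\<pi> t \<omega>) z) y" for z
    using assms(27) by (simp add: fpf_evolution_def)
  \<comment> \<open>An Ito integral includes adaptedness of its integrator, so this is read off the
    filter equation at the arbitrary point \<open>0\<close> and extended to later times by
    monotonicity of \<open>F\<close>.\<close>
  have y: "y s \<in> borel_measurable (F t)" if "t0 \<le> s" "s \<le> t" for s t
  proof -
    have "y s \<in> borel_measurable (F s)"
      using fpf[of 0] that by (fastforce simp: ito_differential_def ito_integral_def)
    then show ?thesis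
      using filtration.sets_F_mono[OF assms(2) that(2)] filtration.space_F[OF assms(2)]
      by (auto simp: measurable_def)
  qed
  have adapted: "(\<lambda>\<omega>. ks_dy_coeff (h t) (R t) (\<pi> t \<omega>) z) \<in> borel_measurable (F t)" if "t \<ge> t0" for t z
  proof (rule ks_dy_coeff_measurable)
    have "(\<lambda>\<omega>. \<omega>) \<in> measurable (F t) (generated_sigma M {t0..t} y)"
      using y by (intro measurable_ident_generated_sigma filtration.space_F[OF assms(2)]) auto
    then have "(\<lambda>w. (fst w, snd w)) \<in>
        measurable (F t \<Otimes>\<^sub>M borel) (generated_sigma M {t0..t} y \<Otimes>\<^sub>M borel)"
      by (intro measurable_Pair measurable_compose[OF measurable_fst] measurable_snd)
    \<comment> \<open>Joint measurability comes from the conditional density of particle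
      \<open>1\<close>, which exists as \<open>N \<ge> 1\<close>.\<close>
    moreover have "(\<lambda>(\<omega>, x). \<pi> t \<omega> x) \<in> borel_measurable (generated_sigma M {t0..t} y \<Otimes>\<^sub>M borel)"
      using assms(24)[OF that, of 1] assms(4) by (simp add: conditional_density_def)
    ultimately show "(\<lambda>(\<omega>, x). \<pi> t \<omega> x) \<in> borel_measurable (F t \<Otimes>\<^sub>M borel)"
      by (auto dest: measurable_compose simp: split_beta')
    have "continuous_on UNIV (h t)"
    proof -
      have "continuous_on UNIV (\<lambda>z. (t, z))"
        by (intro continuous_on_Pair continuous_on_const continuous_on_id)
      moreover have "range (\<lambda>z. (t, z)) \<subseteq> {t0..} \<times> UNIV"
        using that by auto
      ultimately show ?thesis
        using continuous_on_compose2[OF assms(7)] by fastforce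
    qed
    then show "h t \<in> borel_measurable borel"
      by (rule borel_measurable_continuous_onI)
  qed
  \<comment> \<open>Smoothness and the Poisson equation hold for all times off a common null set, so
    the deterministic identity \<open>coeffs\<close> applies pathwise there.\<close>
  have "AE \<omega> in M. \<forall>t\<ge>t0. smooth_density (h t) (\<pi> t \<omega>) \<and> poisson_equation (h t) (R t) (\<pi> t \<omega>) (\<phi> t \<omega>)"
    using assms(25,26) by eventually_elim simp
  then have "AE \<omega> in M. \<forall>t\<ge>t0.
      fpf_drift (f t) (g t) (h t) (R t) (gain (\<phi> t \<omega>)) (\<pi> t \<omega>) z = ks_drift (f t) (g t) (h t) (R t) (\<pi> t \<omega>) z \<and>
      fpf_dy_coeff (gain (\<phi> t \<omega>)) (\<pi> t \<omega>) z = ks_dy_coeff (h t) (R t) (\<pi> t \<omega>) z" for z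
    by eventually_elim (simp add: coeffs)
  then have ks: "ks_evolution M F t0 f g h R y \<pi>"
    unfolding ks_evolution_def
    by (intro allI ito_differential_cong_AE[OF fpf assms(3) adapted])
  have "AE \<omega> in M. \<forall>t\<ge>t0. smooth_density (h t) (\<pi> t \<omega>) \<and> smooth_density (h t) (\<pi>s t \<omega>)"
    using assms(21,25) by eventually_elim simp
  then have "\<forall>t\<ge>t0. AE \<omega> in M. \<pi> t \<omega> = \<pi>s t \<omega>" if "ks_unique M F t0 f g h R y"
    using that ks assms(28,29) unfolding ks_unique_def by blast
  with coeffs ks show ?thesis
    by blast
qed

end
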